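(* Let $Q=(q_{ij})$ be a real symmetric $n\times n$ matrix with zero diagonal, $c\in\mathbb{R}^n$, $R_i=\{j:q_{ij}\neq0\}$, and let $\alpha_{ij}>0$ for $j\in R_i$, $i=1,\dots,n$. Consider the MILP FT($\alpha$) in variables $x_i$ and $y_{ij}$ ($j\in R_i$): maximize $\sum_{i=1}^n\sum_{j\in R_i}q_{ij}y_{ij}+\sum_{i=1}^n c_ix_i$ subject to $\sum_{j\in R_i}\alpha_{ij}(x_j-y_{ij})\le\left(\sum_{j\in R_i}\alpha_{ij}\right)(1-x_i)$ for $i=1,\dots,n$; $y_{ij}-x_i\le 0$ for all $j\in R_i$, $i=1,\dots,n$; $y_{ij}-y_{ji}\le 0$ for all $j\in R_i$, $i=1,\dots,n$; $x_i\in\{0,1\}$ for all $i$; $y_{ij}\ge 0$ for all $j\in R_i$, $i=1,\dots,n$. Then FT($\alpha$) is a valid formulation of QUBO.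
   Context: QUBO is the problem: maximize $\sum_{i=1}^n\sum_{j\in R_i}q_{ij}x_ix_j+\sum_{i=1}^n c_ix_i$ over $x\in\{0,1\}^n$. An MILP in variables $(x,y)$ with objective $\sum_i\sum_{j\in R_i}q_{ij}y_{ij}+\sum_i c_ix_i$ is a valid formulation of QUBO if its optimal objective value equals the optimal value of QUBO and the $x$-part of every optimal solution of the MILP is an optimal solution of QUBO. *)

theory Defs
  imports "HOL-Analysis.Analysis"
begin

definition is_maximizer :: "'a set \<Rightarrow> ('a \<Rightarrow> real) \<Rightarrow> 'a \<Rightarrow> bool" where
  "is_maximizer F f z \<longleftrightarrow> z \<in> F \<and> (\<forall>w\<in>F. f w \<le> f z)"

text \<open>An optimal value is an attained maximum; it is unique when it exists.\<close>

definition is_optimal_value :: "'a set \<Rightarrow> ('a \<Rightarrow> real) \<Rightarrow> real \<Rightarrow> bool" where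
  "is_optimal_value F f v \<longleftrightarrow> (\<exists>z. is_maximizer F f z \<and> f z = v)"

definition R :: "real^'n^'n \<Rightarrow> 'n \<Rightarrow> 'n set" where
  "R Q i = {j. Q $ i $ j \<noteq> 0}"

definition binary_vectors :: "(real^'n) set" where
  "binary_vectors = {x. \<forall>i. x $ i \<in> {0, 1}}"

definition qubo_objective :: "real^'n^'n \<Rightarrow> real^'n \<Rightarrow> real^'n \<Rightarrow> real" where
  "qubo_objective Q c x =
    (\<Sum>i\<in>UNIV. \<Sum>j\<in>R Q i. Q $ i $ j * x $ i * x $ j) + (\<Sum>i\<in>UNIV. c $ i * x $ i)"

definition milp_objective ::
  "real^'n^'n \<Rightarrow> real^'n \<Rightarrow> (real^'n) \<times> ('n \<times> 'n \<Rightarrow> real) \<Rightarrow> real" where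
  "milp_objective Q c = (\<lambda>(x, y).
    (\<Sum>i\<in>UNIV. \<Sum>j\<in>R Q i. Q $ i $ j * y (i, j)) + (\<Sum>i\<in>UNIV. c $ i * x $ i))"

text \<open>All MILPs considered share the objective \<^const>\<open>milp_objective\<close>, so an MILP is given by
  its set of feasible points.\<close>

definition valid_formulation ::
  "real^'n^'n \<Rightarrow> real^'n \<Rightarrow> ((real^'n) \<times> ('n \<times> 'n \<Rightarrow> real)) set \<Rightarrow> bool" where
  "valid_formulation Q c F \<longleftrightarrow>
    (\<exists>v. is_optimal_value F (milp_objective Q c) v \<and>
         is_optimal_value binary_vectors (qubo_objective Q c) v) \<and>
    (\<forall>x y. is_maximizer F (milp_objective Q c) (x, y) \<longrightarrow>
           is_maximizer binary_vectors (qubo_objective Q c) x)"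

text \<open>The variable \<open>y (i, j)\<close> exists only for \<open>j \<in> R Q i\<close>; \<^const>\<open>extensional\<close> pins the
  remaining values of the total function \<open>y\<close> to \<^const>\<open>undefined\<close>.\<close>

definition FT_feasible ::
  "real^'n^'n \<Rightarrow> real^'n^'n \<Rightarrow> ((real^'n) \<times> ('n \<times> 'n \<Rightarrow> real)) set" where
  "FT_feasible Q \<alpha> = {(x, y).
    y \<in> extensional (SIGMA i:UNIV. R Q i) \<and>
    (\<forall>i. (\<Sum>j\<in>R Q i. \<alpha> $ i $ j * (x $ j - y (i, j)))
           \<le> (\<Sum>j\<in>R Q i. \<alpha> $ i $ j) * (1 - x $ i)) \<and>
    (\<forall>i. \<forall>j\<in>R Q i. y (i, j) - x $ i \<le> 0) \<and>
    (\<forall>i. \<forall>j\<in>R Q i. y (i, j) - y (j, i) \<le> 0) \<and>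
    (\<forall>i. x $ i \<in> {0, 1}) \<and>
    (\<forall>i. \<forall>j\<in>R Q i. y (i, j) \<ge> 0)}"

end

theory Submission
  imports Defs
begin

text \<open>The constraints force \<open>y (i, j) = x $ i * x $ j\<close>: symmetry of \<open>Q\<close> gives
  \<open>0 \<le> y (i, j) \<le> min (x $ i) (x $ j)\<close>, and for \<open>x $ i = 1\<close> the weighted inequality bounds a sum
  of nonnegative terms \<open>\<alpha> $ i $ j * (x $ j - y (i, j))\<close> by zero, so each term vanishes. Hence
  feasible points correspond bijectively to binary vectors, with equal objective values.\<close>

text \<open>\<open>restrict\<close> gives the value \<open>undefined\<close> off the index set, as
  \<open>extensional\<close> in \<open>FT_feasible\<close> demands, so a feasible \<open>y\<close>
  can equal the lift as a total function.\<close>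

definition product_lift :: "real^'n^'n \<Rightarrow> real^'n \<Rightarrow> 'n \<times> 'n \<Rightarrow> real" where
  "product_lift Q x = restrict (\<lambda>(i, j). x $ i * x $ j) (SIGMA i:UNIV. R Q i)"

lemma product_lift_apply: "j \<in> R Q i \<Longrightarrow> product_lift Q x (i, j) = x $ i * x $ j"
  by (simp add: product_lift_def)

text \<open>The constraint linking \<open>y (i, j)\<close> to \<open>y (j, i)\<close> evaluates
  \<open>y\<close> at the reversed pair; symmetry of \<open>Q\<close> makes that pair an index too,
  so the bound by \<open>x $ j\<close> is available.\<close>

lemma R_sym:
  assumes "transpose Q = Q" and "j \<in> R Q i"
  shows "i \<in> R Q j"
proof -
  have "Q $ j $ i = transpose Q $ i $ j"
    by (simp add: transpose_def)
  with assms show ?thesis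
    by (simp add: R_def)
qed

lemma FT_feasible_product_lift:
  fixes Q \<alpha> :: "real^'n^'n"
  assumes sym: "transpose Q = Q"
    and pos: "\<And>i j. j \<in> R Q i \<Longrightarrow> \<alpha> $ i $ j > 0"
    and x: "x \<in> binary_vectors"
  shows "(x, product_lift Q x) \<in> FT_feasible Q \<alpha>"
proof -
  have bin: "x $ i = 0 \<or> x $ i = 1" for i
    using x by (simp add: binary_vectors_def)
  have bounds: "0 \<le> x $ i" "x $ i \<le> 1" for i
    using bin[of i] by auto
  have "(\<Sum>j\<in>R Q i. \<alpha> $ i $ j * (x $ j - product_lift Q x (i, j)))
      \<le> (\<Sum>j\<in>R Q i. \<alpha> $ i $ j) * (1 - x $ i)" for i
    unfolding sum_distrib_right
  proof (rule sum_mono)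
    fix j assume j: "j \<in> R Q i"
    \<comment> \<open>The weighted inequality holds term by term: for \<open>x $ i = 0\<close> this
      reads \<open>x $ j \<le> 1\<close>, and for \<open>x $ i = 1\<close> both sides are 0.\<close>
    have "x $ j - product_lift Q x (i, j) \<le> 1 - x $ i"
      using bin[of i] bounds[of j] product_lift_apply[OF j, of x] by auto
    then show "\<alpha> $ i $ j * (x $ j - product_lift Q x (i, j)) \<le> \<alpha> $ i $ j * (1 - x $ i)"
      using pos[OF j] by (simp add: mult_left_mono)
  qed
  moreover have "product_lift Q x (i, j) - x $ i \<le> 0" if "j \<in> R Q i" for i j
    using bin[of i] bounds[of j] product_lift_apply[OF that, of x] by auto
  moreover have "product_lift Q x (i, j) - product_lift Q x (j, i) \<le> 0" if "j \<in> R Q i" for i j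
    using product_lift_apply[OF that, of x] product_lift_apply[OF R_sym[OF sym that], of x] by simp
  moreover have "product_lift Q x (i, j) \<ge> 0" if "j \<in> R Q i" for i j
    using bounds product_lift_apply[OF that, of x] by simp
  ultimately show ?thesis
    using bin by (simp add: FT_feasible_def product_lift_def)
qed

lemma FT_feasible_imp_product_lift:
  fixes Q \<alpha> :: "real^'n^'n"
  assumes sym: "transpose Q = Q"
    and pos: "\<And>i j. j \<in> R Q i \<Longrightarrow> \<alpha> $ i $ j > 0"
    and feas: "(x, y) \<in> FT_feasible Q \<alpha>"
  shows "x \<in> binary_vectors" and "y = product_lift Q x"
proof -
  have ext: "y \<in> extensional (SIGMA i:UNIV. R Q i)"
    and weighted: "\<And>i. (\<Sum>j\<in>R Q i. \<alpha> $ i $ j * (x $ j - y (i, j)))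
        \<le> (\<Sum>j\<in>R Q i. \<alpha> $ i $ j) * (1 - x $ i)"
    and le: "\<And>i j. j \<in> R Q i \<Longrightarrow> y (i, j) \<le> x $ i"
    and le_sym: "\<And>i j. j \<in> R Q i \<Longrightarrow> y (i, j) \<le> y (j, i)"
    and bin: "\<And>i. x $ i = 0 \<or> x $ i = 1"
    and nonneg: "\<And>i j. j \<in> R Q i \<Longrightarrow> 0 \<le> y (i, j)"
    using feas by (auto simp: FT_feasible_def)
  show "x \<in> binary_vectors"
    using bin by (simp add: binary_vectors_def)
  have le': "y (i, j) \<le> x $ j" if "j \<in> R Q i" for i j
    using le_sym[OF that] le[OF R_sym[OF sym that]] by linarith
  have prod: "y (i, j) = x $ i * x $ j" if j: "j \<in> R Q i" for i j
  proof (cases "x $ i = 0")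
    case True
    then show ?thesis
      \<comment> \<open>Here \<open>y (i, j)\<close> is squeezed between 0 and
        \<open>x $ i = 0\<close>.\<close>
      using le[OF j] nonneg[OF j] by simp
  next
    case False
    then have xi: "x $ i = 1"
      using bin by blast
    have terms: "0 \<le> \<alpha> $ i $ k * (x $ k - y (i, k))" if "k \<in> R Q i" for k
      using pos[OF that] le'[OF that] by simp
    have "(\<Sum>k\<in>R Q i. \<alpha> $ i $ k * (x $ k - y (i, k))) \<le> 0"
      using weighted[of i] xi by simp
    moreover have "0 \<le> (\<Sum>k\<in>R Q i. \<alpha> $ i $ k * (x $ k - y (i, k)))"
      using terms by (rule sum_nonneg)
    ultimately have "(\<Sum>k\<in>R Q i. \<alpha> $ i $ k * (x $ k - y (i, k))) = 0"
      by linarith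
    then have "\<forall>k\<in>R Q i. \<alpha> $ i $ k * (x $ k - y (i, k)) = 0"
      using terms by (subst (asm) sum_nonneg_eq_0_iff) auto
    then have "\<alpha> $ i $ j * (x $ j - y (i, j)) = 0"
      using j by blast
    then show ?thesis
      using pos[OF j] xi by simp
  qed
  show "y = product_lift Q x"
    using ext by (rule extensionalityI) (auto simp: product_lift_def prod)
qed

text \<open>Describing the feasible set as the graph of the lift turns maximization over pairs into
  maximization over binary vectors alone.\<close>

lemma FT_feasible_eq:
  fixes Q \<alpha> :: "real^'n^'n"
  assumes "transpose Q = Q"
    and "\<And>i j. j \<in> R Q i \<Longrightarrow> \<alpha> $ i $ j > 0"
  shows "FT_feasible Q \<alpha> = (\<lambda>x. (x, product_lift Q x)) ` binary_vectors"
proof (intro subset_antisym subsetI)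
  fix z assume "z \<in> FT_feasible Q \<alpha>"
  then obtain x y where z: "z = (x, y)" and feas: "(x, y) \<in> FT_feasible Q \<alpha>"
    by (cases z) simp
  have "x \<in> binary_vectors" "y = product_lift Q x"
    using FT_feasible_imp_product_lift[of Q \<alpha> x y] assms feas by simp_all
  with z show "z \<in> (\<lambda>x. (x, product_lift Q x)) ` binary_vectors"
    by simp
next
  fix z assume "z \<in> (\<lambda>x. (x, product_lift Q x)) ` binary_vectors"
  then show "z \<in> FT_feasible Q \<alpha>"
    using FT_feasible_product_lift[of Q \<alpha>] assms by auto
qed

text \<open>Both double sums run over \<open>j \<in> R Q i\<close>, exactly where the lift is the
  product, so the summands differ only by reassociation.\<close>

lemma milp_objective_product_lift:
  "milp_objective Q c (x, product_lift Q x) = qubo_objective Q c x"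
  by (simp add: milp_objective_def qubo_objective_def product_lift_apply mult.assoc)

text \<open>Binary vectors come from functions on the finite index type into a two-element set.
  Finiteness ensures that the optimum is attained.\<close>

lemma finite_binary_vectors: "finite (binary_vectors :: (real^'n) set)"
proof -
  have "(binary_vectors :: (real^'n) set) \<subseteq> vec_lambda ` (UNIV \<rightarrow>\<^sub>E {0, 1})"
  proof
    fix x :: "real^'n"
    assume "x \<in> binary_vectors"
    then have "($) x \<in> UNIV \<rightarrow>\<^sub>E {0, 1}"
      by (auto simp: binary_vectors_def)
    then show "x \<in> vec_lambda ` (UNIV \<rightarrow>\<^sub>E {0, 1})"
      by (rule rev_image_eqI) simp
  qed
  then show ?thesis
    by (rule finite_subset) (simp add: finite_PiE)
qed

lemma is_maximizer_exists:
  assumes "finite F" and "F \<noteq> {}"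
  shows "\<exists>z. is_maximizer F f z"
proof -
  have "Max (f ` F) \<in> f ` F"
    using assms by simp
  then obtain z where "z \<in> F" "f z = Max (f ` F)"
    by auto
  then show ?thesis
    using assms by (auto simp: is_maximizer_def)
qed

theorem theorem5:
  fixes Q \<alpha> :: "real^'n^'n" and c :: "real^'n"
  assumes "transpose Q = Q"
    and "\<And>i. Q $ i $ i = 0"
    and "\<And>i j. j \<in> R Q i \<Longrightarrow> \<alpha> $ i $ j > 0"
  shows "valid_formulation Q c (FT_feasible Q \<alpha>)"
proof -
  have feasible: "FT_feasible Q \<alpha> = (\<lambda>x. (x, product_lift Q x)) ` binary_vectors"
    using assms(1,3) by (rule FT_feasible_eq)
  \<comment> \<open>Reparametrizing by the lift leaves the same objective values over the same
    vectors, so the maximality conditions coincide.\<close>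
  have lift_iff: "is_maximizer (FT_feasible Q \<alpha>) (milp_objective Q c) (x, product_lift Q x)
      \<longleftrightarrow> is_maximizer binary_vectors (qubo_objective Q c) x" for x
    unfolding is_maximizer_def feasible by (auto simp: milp_objective_product_lift)
  have "(0 :: real^'n) \<in> binary_vectors"
    by (simp add: binary_vectors_def)
  then obtain x where "is_maximizer binary_vectors (qubo_objective Q c) x"
    using is_maximizer_exists[OF finite_binary_vectors] by blast
  then have "is_optimal_value (FT_feasible Q \<alpha>) (milp_objective Q c) (qubo_objective Q c x)"
    and "is_optimal_value binary_vectors (qubo_objective Q c) (qubo_objective Q c x)"
    unfolding is_optimal_value_def using lift_iff[of x] milp_objective_product_lift[of Q c x] by blast+
  moreover have "is_maximizer binary_vectors (qubo_objective Q c) x"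
    if max: "is_maximizer (FT_feasible Q \<alpha>) (milp_objective Q c) (x, y)" for x y
  proof -
    \<comment> \<open>An optimal \<open>y\<close> is arbitrary a priori; feasibility identifies it
      with the lift, so that \<open>lift_iff\<close> applies.\<close>
    have "y = product_lift Q x"
      using max by (auto simp: is_maximizer_def feasible)
    then show ?thesis
      using max lift_iff by simp
  qed
  ultimately show ?thesis
    unfolding valid_formulation_def by blast
qed

end
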